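(* There exists a constant $\alpha>0$ such that the following holds. For even $n$, let $M_1,M_2,M_3$ be independent uniformly chosen random perfect matchings on a common set of $n$ vertices (i.e. of the complete graph $K_n$), and let $G=M_1\cup M_2\cup M_3$. Then with high probability $\alpha n$ cops do not suffice to catch the robber on $G$; that is, $\Pr[\mathrm{ent}(G)>\alpha n]\to 1$ as $n\to\infty$ through even integers.
   Context: Entanglement game on a finite graph $G$ with $k$ cops: First the robber chooses a starting vertex, and all $k$ cops are outside the graph. In every turn, the cops either all stay where they are, or exactly one of them flies (from wherever it is, on or off the graph) to the current position of the robber. Regardless of which of these happened, the robber then has to move to a neighbor of his current position that is not occupied by a cop. If there is no such neighbor, the cops win. The robber wins if he can run away indefinitely. Both sides have full information. The entanglement number $\mathrm{ent}(G)$ is the minimal integer $k$ such that $k$ cops have a strategy to catch the robber on $G$. "$\alpha n$ cops do not suffice" means that no integer number $k\le\alpha n$ of cops can catch the robber, i.e. $\mathrm{ent}(G)>\alpha n$. The union of matchings is the graph on the $n$ vertices whose edge set is the union of the three edge sets. "With high probability" means with probability tending to $1$ as $n\to\infty$. *)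

theory Defs
  imports "HOL-Probability.Probability"
begin

section \<open>The entanglement game\<close>

text \<open>A graph is given by a vertex set \<open>V\<close> and a set \<open>E\<close> of two-element subsets of \<open>V\<close>.
  Cops are numbered by the naturals below \<open>k\<close>; a position \<open>None\<close> means off the graph. A robber
  trajectory \<open>r\<close> gives his position \<open>r t\<close> before turn \<open>t\<close>. In turn \<open>t\<close> the cops know the history
  \<open>[r 0, \<dots>, r t]\<close> and answer either \<open>None\<close> (all stay) or \<open>Some i\<close> (cop \<open>i\<close> flies to \<open>r t\<close>).
  The past cop moves are determined by the strategy and the robber's history, so this is full
  information with strategies of unrestricted memory.\<close>

type_synonym 'a cop_strategy = "'a list \<Rightarrow> nat option"

definition legal_strategy :: "nat \<Rightarrow> 'a cop_strategy \<Rightarrow> bool" where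
  "legal_strategy k \<sigma> \<longleftrightarrow> (\<forall>h i. \<sigma> h = Some i \<longrightarrow> i < k)"

fun cop_pos :: "'a cop_strategy \<Rightarrow> (nat \<Rightarrow> 'a) \<Rightarrow> nat \<Rightarrow> nat \<Rightarrow> 'a option" where
  "cop_pos \<sigma> r 0 = (\<lambda>i. None)"
| "cop_pos \<sigma> r (Suc t) =
     (case \<sigma> (map r [0..<Suc t]) of
        None \<Rightarrow> cop_pos \<sigma> r t
      | Some i \<Rightarrow> (cop_pos \<sigma> r t)(i := Some (r t)))"

definition robber_escapes ::
  "nat \<Rightarrow> 'a set \<Rightarrow> 'a set set \<Rightarrow> 'a cop_strategy \<Rightarrow> (nat \<Rightarrow> 'a) \<Rightarrow> bool" where
  "robber_escapes k V E \<sigma> r \<longleftrightarrow>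
     r 0 \<in> V \<and>
     (\<forall>t. {r t, r (Suc t)} \<in> E \<and> (\<forall>i<k. cop_pos \<sigma> r (Suc t) i \<noteq> Some (r (Suc t))))"

text \<open>A play is won by the cops iff the robber eventually has no legal move, that is, iff it is
  not infinite.\<close>

definition cops_win :: "nat \<Rightarrow> 'a set \<Rightarrow> 'a set set \<Rightarrow> bool" where
  "cops_win k V E \<longleftrightarrow> (\<exists>\<sigma>. legal_strategy k \<sigma> \<and> (\<forall>r. \<not> robber_escapes k V E \<sigma> r))"

definition ent :: "'a set \<Rightarrow> 'a set set \<Rightarrow> nat" where
  "ent V E = (LEAST k. cops_win k V E)"

text \<open>On a finite graph the minimum is attained: \<open>card V\<close> cops can block every visited vertex.\<close>

lemma cops_win_card:
  assumes "finite V" "\<Union>E \<subseteq> V"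
  shows "cops_win (card V) V E"
proof -
  define k where "k = card V"
  define \<sigma> :: "'a cop_strategy" where
    "\<sigma> = (\<lambda>h. if length h - 1 < k then Some (length h - 1) else None)"
  have legal: "legal_strategy k \<sigma>"
    by (auto simp: legal_strategy_def \<sigma>_def split: if_splits)
  have pos: "cop_pos \<sigma> r t s = Some (r s)" if "s < t" "s < k" for r t s
    using that
  proof (induction t)
    case (Suc t)
    then show ?case by (cases "s = t") (auto simp: \<sigma>_def)
  qed simp
  have "\<not> robber_escapes k V E \<sigma> r" for r
  proof
    assume esc: "robber_escapes k V E \<sigma> r"
    have inV: "r t \<in> V" for t
      using esc assms(2) unfolding robber_escapes_def by blast
    have neq: "r i \<noteq> r j" if "i < j" "j \<le> k" for i j
    proof -
      obtain t where t: "j = Suc t" using \<open>i < j\<close> by (cases j) auto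
      have "i < k" using that by simp
      moreover from this have "cop_pos \<sigma> r (Suc t) i = Some (r i)"
        using that t by (intro pos) auto
      ultimately show ?thesis
        using esc t unfolding robber_escapes_def by metis
    qed
    have "inj_on r {..k}"
      by (rule linorder_inj_onI) (use neq in auto)
    then have "card (r ` {..k}) = Suc k" by (simp add: card_image)
    moreover have "card (r ` {..k}) \<le> card V"
      using inV assms(1) by (intro card_mono) auto
    ultimately show False by (simp add: k_def)
  qed
  with legal show ?thesis unfolding cops_win_def k_def by blast
qed

lemma cops_win_ent:
  assumes "finite V" "\<Union>E \<subseteq> V"
  shows "cops_win (ent V E) V E"
  unfolding ent_def using cops_win_card[OF assms] by (rule LeastI)

section \<open>Random perfect matchings\<close>

definition perfect_matchings :: "nat \<Rightarrow> nat set set set" where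
  "perfect_matchings n =
     {M. (\<forall>e\<in>M. e \<subseteq> {..<n} \<and> card e = 2) \<and> (\<forall>v<n. \<exists>!e. e \<in> M \<and> v \<in> e)}"

text \<open>The next two facts make \<open>pmf_of_set (perfect_matchings n)\<close> meaningful for even \<open>n\<close>;
  for odd \<open>n\<close> there are no perfect matchings.\<close>

lemma finite_perfect_matchings: "finite (perfect_matchings n)"
  by (rule finite_subset[of _ "Pow (Pow {..<n})"]) (auto simp: perfect_matchings_def)

lemma perfect_matchings_nonempty:
  assumes "even n"
  shows "perfect_matchings n \<noteq> {}"
proof -
  obtain m where n: "n = 2 * m" using assms by blast
  define M where "M = (\<lambda>i. {2 * i, Suc (2 * i)}) ` {..<m}"
  have "\<forall>e\<in>M. e \<subseteq> {..<n} \<and> card e = 2"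
    by (auto simp: M_def n)
  moreover have "\<exists>!e. e \<in> M \<and> v \<in> e" if "v < n" for v
  proof (rule ex1I[of _ "{2 * (v div 2), Suc (2 * (v div 2))}"])
    have "v = 2 * (v div 2) \<or> v = Suc (2 * (v div 2))" by presburger
    then show "{2 * (v div 2), Suc (2 * (v div 2))} \<in> M \<and> v \<in> {2 * (v div 2), Suc (2 * (v div 2))}"
      using that by (auto simp: M_def n)
  next
    fix e assume "e \<in> M \<and> v \<in> e"
    then show "e = {2 * (v div 2), Suc (2 * (v div 2))}"
      by (auto simp: M_def)
  qed
  ultimately have "M \<in> perfect_matchings n"
    by (simp add: perfect_matchings_def)
  then show ?thesis by blast
qed

definition random_matching :: "nat \<Rightarrow> nat set set pmf" where
  "random_matching n = pmf_of_set (perfect_matchings n)"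

definition three_random_matchings :: "nat \<Rightarrow> (nat set set \<times> nat set set \<times> nat set set) pmf" where
  "three_random_matchings n =
     pair_pmf (random_matching n) (pair_pmf (random_matching n) (random_matching n))"

end

(* If every set C of at most k + 1 vertices leaves a component of G - C with more than n / 2
   vertices, the robber survives against k cops by always stepping into this giant component.
   Otherwise, for some C with at most k + 1 vertices, G - C splits into two parts without edges
   between them, each with at least a third of the vertices of G - C. Let A be one of the parts. For
   each of the three matchings, the union of its edges meeting A lies between A and A Un C, so the
   three matchings have saturated sets (unions of matching edges) that pairwise differ in at most
   k + 1 vertices. With n = 2 m, M1 has 2^m saturated sets, and a given set of size 2 s is saturated
   by M2 with probability at most 1 / (m choose s), and likewise by M3. Since s is roughly between
   m / 3 and 2 m / 3, (m choose s)^2 exceeds 2^m by an exponential factor, which for small k / n also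
   absorbs the number of sets within Hamming distance k + 1 of a given one. Numerically,
   (m choose 3 m / 10) is roughly at least (10 / 3)^(3 m / 10), and (10 / 3)^3 > 2^5. *)
theory Submission
  imports Defs
begin

section \<open>The robber follows the giant component\<close>

text \<open>Outside \<open>C\<close> the classes of this equivalence are the components of G - C.
  The closure is reflexive everywhere, so a vertex of \<open>C\<close> forms a class of its
  own.\<close>

definition reach :: "'a set set \<Rightarrow> 'a set \<Rightarrow> ('a \<times> 'a) set" where
  "reach E C = {(x, y). {x, y} \<in> E \<and> x \<notin> C \<and> y \<notin> C}\<^sup>*"

text \<open>The threshold is half of all of \<open>V\<close>, not of \<open>V - C\<close>. It thus
  does not depend on \<open>C\<close>, and being in the giant component is inherited by subsets of
  \<open>C\<close>.\<close>

definition in_giant :: "'a set \<Rightarrow> 'a set set \<Rightarrow> 'a set \<Rightarrow> 'a \<Rightarrow> bool" where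
  "in_giant V E C v \<longleftrightarrow> v \<in> V - C \<and> card V < 2 * card (reach E C `` {v})"

lemma reach_refl [simp]: "(x, x) \<in> reach E C"
  by (simp add: reach_def)

lemma reach_trans: "(x, y) \<in> reach E C \<Longrightarrow> (y, z) \<in> reach E C \<Longrightarrow> (x, z) \<in> reach E C"
  by (simp add: reach_def)

lemma reach_sym:
  assumes "(x, y) \<in> reach E C"
  shows "(y, x) \<in> reach E C"
proof -
  have "sym (reach E C)"
    unfolding reach_def by (intro sym_rtrancl) (auto simp: sym_def insert_commute)
  then show ?thesis
    using assms by (rule symD)
qed

lemma reach_antimono: "C \<subseteq> D \<Longrightarrow> reach E D \<subseteq> reach E C"
  unfolding reach_def by (intro rtrancl_mono) auto

lemma reach_Image_eq: "(x, y) \<in> reach E C \<Longrightarrow> reach E C `` {x} = reach E C `` {y}"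
  by (auto intro: reach_trans reach_sym)

lemma reach_closed:
  assumes "(x, y) \<in> reach E C" "x \<in> V - C" "\<Union>E \<subseteq> V"
  shows "y \<in> V - C"
  using assms(1) unfolding reach_def by (induction) (use assms(2,3) in auto)

lemma reach_Image_subset: "x \<in> V - C \<Longrightarrow> \<Union>E \<subseteq> V \<Longrightarrow> reach E C `` {x} \<subseteq> V - C"
  using reach_closed[of x _ E C V] by blast

text \<open>Cut a walk from \<open>r\<close> to \<open>u\<close> after its last visit to
  \<open>r\<close>; the remaining walk avoids \<open>r\<close>.\<close>

lemma reach_last_exit:
  assumes "(r, u) \<in> reach E C" "u \<noteq> r"
  shows "\<exists>w. {r, w} \<in> E \<and> w \<notin> insert r C \<and> (w, u) \<in> reach E (insert r C)"
proof -
  let ?P = "\<lambda>u. \<exists>w. {r, w} \<in> E \<and> w \<notin> insert r C \<and> (w, u) \<in> reach E (insert r C)"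
  have "u = r \<or> ?P u"
    using assms(1) unfolding reach_def[of E C]
  proof (induction rule: rtrancl_induct)
    case (step u u')
    then have edge: "{u, u'} \<in> E" "u \<notin> C" "u' \<notin> C"
      by auto
    \<comment> \<open>A return to \<open>r\<close> discards the walk so far, a step out of
      \<open>r\<close> restarts it at \<open>u'\<close>, and any other step prolongs the part after
      the last visit.\<close>
    consider "u' = r" | "u = r" "u' \<noteq> r" | "u \<noteq> r" "u' \<noteq> r"
      by blast
    then show ?case
    proof cases
      case 2
      then have "{r, u'} \<in> E \<and> u' \<notin> insert r C \<and> (u', u') \<in> reach E (insert r C)"
        using edge by simp
      then show ?thesis by blast
    next
      case 3
      then have "(u, u') \<in> reach E (insert r C)"
        using edge unfolding reach_def by (intro r_into_rtrancl) simp
      with 3 show ?thesis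
        using step.IH reach_trans by metis
    qed simp
  qed simp
  with assms(2) show ?thesis by blast
qed

lemma in_giant_antimono:
  assumes "in_giant V E D v" "C \<subseteq> D" "finite V" "\<Union>E \<subseteq> V"
  shows "in_giant V E C v"
proof -
  have v: "v \<in> V - C"
    using assms by (auto simp: in_giant_def)
  have "finite (reach E C `` {v})"
    using reach_Image_subset[OF v assms(4)] assms(3) by (meson finite_Diff finite_subset)
  then have "card (reach E D `` {v}) \<le> card (reach E C `` {v})"
    using reach_antimono[OF assms(2), of E] by (intro card_mono) auto
  then show ?thesis
    using assms(1) v by (simp add: in_giant_def)
qed

lemma in_giant_connected:
  assumes "in_giant V E C u" "in_giant V E C v" "finite V" "\<Union>E \<subseteq> V"
  shows "(u, v) \<in> reach E C"
proof (rule ccontr)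
  let ?U = "reach E C `` {u}" and ?W = "reach E C `` {v}"
  assume "(u, v) \<notin> reach E C"
  then have "?U \<inter> ?W = {}"
    using reach_sym reach_trans by fast
  moreover have sub: "?U \<subseteq> V" "?W \<subseteq> V"
    using assms reach_Image_subset[of _ V C E] by (auto simp: in_giant_def)
  moreover have "finite ?U" "finite ?W"
    using sub assms(3) finite_subset by auto
  ultimately have "card ?U + card ?W \<le> card V"
    using assms(3) by (subst card_Un_disjoint [symmetric]) (auto intro!: card_mono)
  then show False
    using assms(1,2) by (simp add: in_giant_def)
qed

text \<open>The giant component that survives the removal of \<open>r\<close> lies inside the one
  containing \<open>r\<close>, so some walk leads there from \<open>r\<close>. Its first vertex
  after the last visit to \<open>r\<close> is the required neighbour.\<close>

lemma in_giant_step: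
  assumes "in_giant V E C r" "in_giant V E (insert r C) u" "finite V" "\<Union>E \<subseteq> V"
  shows "\<exists>w. {r, w} \<in> E \<and> in_giant V E (insert r C) w"
proof -
  have "in_giant V E C u"
    using assms by (blast intro: in_giant_antimono)
  then have "(r, u) \<in> reach E C"
    using assms by (blast intro: in_giant_connected)
  moreover have "u \<noteq> r"
    using assms(2) by (auto simp: in_giant_def)
  ultimately obtain w where w: "{r, w} \<in> E" "w \<notin> insert r C" "(w, u) \<in> reach E (insert r C)"
    using reach_last_exit by metis
  then have "in_giant V E (insert r C) w"
    using assms(2,4) reach_Image_eq[OF w(3)] by (auto simp: in_giant_def)
  with w(1) show ?thesis by blast
qed

text \<open>The robber's next vertex lies in the giant component avoiding both the present cops and his
  own position, so it can be chosen before the cops move.\<close>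

lemma not_cops_win_if_giant:
  assumes fin: "finite V" and E: "\<Union>E \<subseteq> V"
    and giant: "\<And>C. C \<subseteq> V \<Longrightarrow> card C \<le> Suc k \<Longrightarrow> \<exists>v. in_giant V E C v"
  shows "\<not> cops_win k V E"
proof
  assume "cops_win k V E"
  then obtain \<sigma> where \<sigma>: "\<And>r. \<not> robber_escapes k V E \<sigma> r"
    unfolding cops_win_def by blast
  define occ where "occ p = {v. \<exists>i<k. p i = Some v}" for p :: "nat \<Rightarrow> 'a option"
  have occ_card: "finite (occ p) \<and> card (occ p) \<le> k" for p
  proof -
    have "occ p \<subseteq> (\<lambda>i. the (p i)) ` {..<k}"
      by (force simp: occ_def)
    then show ?thesis
      using finite_subset surj_card_le[OF finite_lessThan] by fastforce
  qed
  obtain v0 where v0: "in_giant V E {} v0"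
    using giant[of "{}"] by auto
  define next_pos where
    "next_pos p x = (SOME w. {x, w} \<in> E \<and> in_giant V E (insert x (occ p)) w)" for p x
  have next_pos: "{x, next_pos p x} \<in> E \<and> in_giant V E (insert x (occ p)) (next_pos p x)"
    if x: "in_giant V E (occ p) x" and p: "occ p \<subseteq> V" for p x
  proof -
    \<comment> \<open>The \<open>k\<close> cops and the robber's own vertex: this is where
      \<open>Suc k\<close> comes from.\<close>
    have "x \<in> V" "card (insert x (occ p)) \<le> Suc k"
      using x occ_card[of p] by (auto simp: in_giant_def card_insert_if)
    then obtain u where "in_giant V E (insert x (occ p)) u"
      using giant[of "insert x (occ p)"] p by auto
    from in_giant_step[OF x this fin E] show ?thesis
      unfolding next_pos_def by (rule someI_ex)
  qed
  \<comment> \<open>\<open>cop_pos\<close> takes a whole trajectory as argument, so the trajectory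
    cannot be defined by recursion through it. The recursion builds history and cop positions side
    by side; fact \<open>st\<close> identifies the latter with \<open>cop_pos\<close>
    afterwards.\<close>
  define st where "st = rec_nat ([v0], \<lambda>i::nat. None) (\<lambda>_ s.
     (fst s @ [next_pos (snd s) (last (fst s))],
      case \<sigma> (fst s) of None \<Rightarrow> snd s | Some i \<Rightarrow> (snd s)(i := Some (last (fst s)))))"
  define r where "r t = last (fst (st t))" for t
  have st_0: "st 0 = ([v0], \<lambda>i. None)"
    by (simp add: st_def)
  have st_Suc: "st (Suc t) = (fst (st t) @ [next_pos (snd (st t)) (r t)],
      case \<sigma> (fst (st t)) of None \<Rightarrow> snd (st t) | Some i \<Rightarrow> (snd (st t))(i := Some (r t)))" for t
    unfolding st_def r_def by simp
  have r0: "r 0 = v0"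
    by (simp add: r_def st_0)
  have st: "st t = (map r [0..<Suc t], cop_pos \<sigma> r t)" for t
  proof (induction t)
    case 0
    then show ?case by (simp add: r0 st_0)
  next
    case (Suc t)
    have "r (Suc t) = next_pos (snd (st t)) (r t)"
      unfolding r_def[of "Suc t"] st_Suc by simp
    then show ?case by (simp add: st_Suc Suc split: option.split)
  qed
  have rSuc: "r (Suc t) = next_pos (cop_pos \<sigma> r t) (r t)" for t
    unfolding r_def[of "Suc t"] st_Suc by (simp add: st)
  have occ_Suc: "occ (cop_pos \<sigma> r (Suc t)) \<subseteq> insert (r t) (occ (cop_pos \<sigma> r t))" for t
    by (auto simp: occ_def split: option.splits if_splits)
  have inv: "in_giant V E (occ (cop_pos \<sigma> r t)) (r t) \<and> occ (cop_pos \<sigma> r t) \<subseteq> V" for t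
  proof (induction t)
    case 0
    then show ?case using v0 by (simp add: r0 occ_def)
  next
    case (Suc t)
    then have "in_giant V E (insert (r t) (occ (cop_pos \<sigma> r t))) (r (Suc t))"
      using next_pos by (simp add: rSuc)
    then have "in_giant V E (occ (cop_pos \<sigma> r (Suc t))) (r (Suc t))"
      using occ_Suc[of t] fin E by (blast intro: in_giant_antimono)
    moreover have "occ (cop_pos \<sigma> r (Suc t)) \<subseteq> V"
      using occ_Suc[of t] Suc by (auto simp: in_giant_def)
    ultimately show ?case by blast
  qed
  have "r 0 \<in> V"
    using v0 by (simp add: r0 in_giant_def)
  moreover have "{r t, r (Suc t)} \<in> E" for t
    using next_pos inv[of t] by (simp add: rSuc)
  moreover have "cop_pos \<sigma> r (Suc t) i \<noteq> Some (r (Suc t))" if "i < k" for t i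
    using inv[of "Suc t"] that unfolding in_giant_def occ_def by blast
  ultimately have "robber_escapes k V E \<sigma> r"
    unfolding robber_escapes_def by blast
  with \<sigma> show False by blast
qed

section \<open>Balanced separators\<close>

text \<open>A smallest union of components with a third of the vertices works: if it had more than two
  thirds, each of its components would have more than a third, so it would be one giant component.\<close>

lemma balanced_separator:
  assumes fin: "finite V" and E: "\<Union>E \<subseteq> V" "\<And>e. e \<in> E \<Longrightarrow> card e = 2"
    and C: "C \<subseteq> V" "4 * card C \<le> card V" and no_giant: "\<And>v. \<not> in_giant V E C v"
  obtains A where "A \<subseteq> V - C" "\<And>e. e \<in> E \<Longrightarrow> e \<inter> A \<noteq> {} \<Longrightarrow> e \<subseteq> A \<union> C"
    "card (V - C) \<le> 3 * card A" "3 * card A \<le> 2 * card (V - C)"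
proof -
  define P where "P A \<longleftrightarrow> A \<subseteq> V - C \<and> reach E C `` A \<subseteq> A \<and> card (V - C) \<le> 3 * card A" for A
  have "P (V - C)"
    using reach_Image_subset[OF _ E(1), of _ C] by (auto simp: P_def)
  then obtain A where PA: "P A" and least: "\<And>B. P B \<Longrightarrow> card A \<le> card B"
    using ex_has_least_nat[of P "V - C" card] by blast
  have finA: "finite A"
    using PA fin by (auto simp: P_def intro: finite_subset)
  show ?thesis
  proof (rule that)
    show "A \<subseteq> V - C" "card (V - C) \<le> 3 * card A"
      using PA by (auto simp: P_def)
    show "e \<subseteq> A \<union> C" if e: "e \<in> E" "e \<inter> A \<noteq> {}" for e
    proof
      fix y assume y: "y \<in> e"
      obtain x where x: "x \<in> e" "x \<in> A" using e by blast
      show "y \<in> A \<union> C"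
      proof (cases "x = y \<or> y \<in> C")
        case False
        then have "e = {x, y}"
          using x y E(2)[OF e(1)] by (auto simp: card_2_iff)
        then have "(x, y) \<in> reach E C"
          using e x False PA unfolding reach_def P_def by (intro r_into_rtrancl) auto
        then show ?thesis using PA x by (auto simp: P_def)
      qed (use x in auto)
    qed
    show "3 * card A \<le> 2 * card (V - C)"
    proof (rule ccontr)
      assume big: "\<not> ?thesis"
      then have "A \<noteq> {}" by auto
      then obtain a where a: "a \<in> A" by blast
      define K where "K = reach E C `` {a}"
      have K: "K \<subseteq> A" "a \<in> K"
        using a PA by (auto simp: K_def P_def)
      \<comment> \<open>\<open>A - K\<close> is again a union of components and smaller than
        \<open>A\<close>, so it has less than a third of \<open>V - C\<close>. As \<open>A\<close>
        has more than two thirds, more than a third is left for \<open>K\<close>.\<close>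
      have "reach E C `` (A - K) \<subseteq> A - K"
        using PA unfolding K_def P_def by (auto intro: reach_trans reach_sym)
      moreover have "card (A - K) < card A"
        using K finA by (intro psubset_card_mono) auto
      ultimately have "3 * card (A - K) < card (V - C)"
        using least[of "A - K"] PA by (force simp: P_def)
      moreover have card_A: "card A = card (A - K) + card K"
        using card_Un_disjoint[of "A - K" K] finite_subset[OF K(1) finA] K(1) finA
        by (auto simp: Un_absorb2)
      ultimately have "card (V - C) \<le> 3 * card K"
        using big by linarith
      then have "P K"
        using K PA unfolding P_def K_def by (auto intro: reach_trans)
      then have "card A \<le> card K"
        by (rule least)
      \<comment> \<open>Now 3 |K| is at least 3 |A| > 2 (|V| - |C|), and this is at least 3/2 |V|
        because |C| is at most |V| / 4.\<close>
      moreover have "card (V - C) = card V - card C"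
        using C fin by (meson card_Diff_subset finite_subset)
      ultimately have "card V < 2 * card K"
        using big C by linarith
      then show False
        using no_giant[of a] a PA by (auto simp: in_giant_def K_def P_def)
    qed
  qed
qed

section \<open>Sets saturated by a random matching\<close>

definition saturated :: "nat set set \<Rightarrow> nat set set" where
  "saturated M = Union ` Pow M"

lemma saturated_subset: "S \<in> saturated M \<Longrightarrow> S \<subseteq> \<Union>M"
  by (auto simp: saturated_def)

lemma Union_perfect_matching: "M \<in> perfect_matchings n \<Longrightarrow> \<Union>M = {..<n}"
  unfolding perfect_matchings_def by blast

lemma finite_perfect_matching: "M \<in> perfect_matchings n \<Longrightarrow> finite M"
  using Union_perfect_matching by (metis finite_UnionD finite_lessThan)

lemma card_edge_perfect_matching: "M \<in> perfect_matchings n \<Longrightarrow> e \<in> M \<Longrightarrow> card e = 2"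
  unfolding perfect_matchings_def by blast

lemma perfect_matching_unique:
  "M \<in> perfect_matchings n \<Longrightarrow> e \<in> M \<Longrightarrow> f \<in> M \<Longrightarrow> v \<in> e \<Longrightarrow> v \<in> f \<Longrightarrow> e = f"
  unfolding perfect_matchings_def by blast

lemma finite_saturated: "M \<in> perfect_matchings n \<Longrightarrow> finite (saturated M)"
  by (simp add: saturated_def finite_perfect_matching)

lemma card_Union_matching:
  assumes "M \<in> perfect_matchings n" "F \<subseteq> M"
  shows "card (\<Union>F) = 2 * card F"
proof -
  have "pairwise disjnt F"
    using assms perfect_matching_unique[OF assms(1)]
    unfolding pairwise_def disjnt_def by blast
  moreover have "card e = 2" if "e \<in> F" for e
    using assms that card_edge_perfect_matching by blast
  moreover from this have "finite e" if "e \<in> F" for e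
    using that by (metis card.infinite zero_neq_numeral)
  ultimately show ?thesis
    by (simp add: card_Union_disjoint)
qed

lemma card_perfect_matching: "M \<in> perfect_matchings (2 * m) \<Longrightarrow> card M = m"
  using card_Union_matching[of M "2 * m" M] by (simp add: Union_perfect_matching)

lemma even_card_saturated:
  "M \<in> perfect_matchings n \<Longrightarrow> S \<in> saturated M \<Longrightarrow> even (card S)"
  by (auto simp: saturated_def card_Union_matching)

lemma ex_saturated_hull:
  assumes M: "M \<in> perfect_matchings n" and A: "A \<subseteq> {..<n}"
    and closed: "\<And>e. e \<in> M \<Longrightarrow> e \<inter> A \<noteq> {} \<Longrightarrow> e \<subseteq> A \<union> C"
  shows "\<exists>S\<in>saturated M. A \<subseteq> S \<and> S \<subseteq> A \<union> C"
proof
  let ?S = "\<Union>{e\<in>M. e \<inter> A \<noteq> {}}"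
  show "?S \<in> saturated M"
    by (auto simp: saturated_def)
  have "x \<in> \<Union>M" if "x \<in> A" for x
    using that A Union_perfect_matching[OF M] by blast
  then show "A \<subseteq> ?S \<and> ?S \<subseteq> A \<union> C"
    using closed by blast
qed

lemma card_saturated_le:
  assumes "M \<in> perfect_matchings (2 * m)"
  shows "card (saturated M) \<le> 2 ^ m"
proof -
  have "card (saturated M) \<le> card (Pow M)"
    unfolding saturated_def using assms by (intro card_image_le) (simp add: finite_perfect_matching)
  then show ?thesis
    using assms by (simp add: card_Pow finite_perfect_matching card_perfect_matching)
qed

lemma card_saturated_size_le:
  assumes M: "M \<in> perfect_matchings (2 * m)"
  shows "card {S \<in> saturated M. card S = 2 * s} \<le> m choose s"
proof -
  have fin: "finite M"
    using M by (rule finite_perfect_matching)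
  have "{S \<in> saturated M. card S = 2 * s} \<subseteq> Union ` {F. F \<subseteq> M \<and> card F = s}"
    using M by (auto simp: saturated_def card_Union_matching)
  moreover have "finite {F. F \<subseteq> M \<and> card F = s}"
    using fin by simp
  ultimately have "card {S \<in> saturated M. card S = 2 * s} \<le> card {F. F \<subseteq> M \<and> card F = s}"
    by (rule surj_card_le[rotated])
  also have "\<dots> = m choose s"
    using n_subsets[OF fin] card_perfect_matching[OF M] by simp
  finally show ?thesis .
qed

section \<open>Symmetry under permutations of the vertices\<close>

lemma image_perfect_matching:
  assumes M: "M \<in> perfect_matchings n" and \<pi>: "bij_betw \<pi> {..<n} {..<n}"
  shows "(`) \<pi> ` M \<in> perfect_matchings n"
  unfolding perfect_matchings_def
proof (intro CollectI conjI ballI allI impI)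
  have inj: "inj_on \<pi> {..<n}" and img: "\<pi> ` {..<n} = {..<n}"
    using \<pi> by (auto simp: bij_betw_def)
  have sub: "e \<subseteq> {..<n}" if "e \<in> M" for e
    using Union_perfect_matching[OF M] that by blast
  fix e' assume "e' \<in> (`) \<pi> ` M"
  then obtain e where e: "e \<in> M" "e' = \<pi> ` e" by blast
  show "e' \<subseteq> {..<n}"
    using sub[OF e(1)] img e(2) by blast
  show "card e' = 2"
    using card_image[OF inj_on_subset[OF inj sub[OF e(1)]]] card_edge_perfect_matching[OF M e(1)] e(2)
    by simp
next
  have inj: "inj_on \<pi> {..<n}" and img: "\<pi> ` {..<n} = {..<n}"
    using \<pi> by (auto simp: bij_betw_def)
  fix v assume "v < n"
  then obtain u where u: "u < n" "v = \<pi> u"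
    using img by (metis imageE lessThan_iff)
  then obtain e where e: "e \<in> M" "u \<in> e"
    using Union_perfect_matching[OF M] by blast
  show "\<exists>!e'. e' \<in> (`) \<pi> ` M \<and> v \<in> e'"
  proof (rule ex1I[of _ "\<pi> ` e"])
    show "\<pi> ` e \<in> (`) \<pi> ` M \<and> v \<in> \<pi> ` e"
      using e u by blast
  next
    fix e' assume "e' \<in> (`) \<pi> ` M \<and> v \<in> e'"
    then obtain f w where f: "f \<in> M" "e' = \<pi> ` f" "w \<in> f" "v = \<pi> w" by blast
    then have "w < n"
      using Union_perfect_matching[OF M] by blast
    then have "w = u"
      using inj_onD[OF inj, of w u] f u by simp
    then have "f = e"
      using perfect_matching_unique[OF M f(1) e(1)] f e by blast
    then show "e' = \<pi> ` e"
      using f by simp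
  qed
qed

text \<open>A permutation of the vertices that takes \<open>S\<close> to \<open>T\<close> acts
  injectively on perfect matchings and carries those saturating \<open>S\<close> to ones saturating
  \<open>T\<close>. Exchanging \<open>S\<close> and \<open>T\<close> gives equality.\<close>

lemma card_saturating_mono:
  assumes S: "S \<subseteq> {..<n}" and T: "T \<subseteq> {..<n}" and card: "card S = card T"
  shows "card {M \<in> perfect_matchings n. S \<in> saturated M} \<le> card {M \<in> perfect_matchings n. T \<in> saturated M}"
proof -
  have fin: "finite S" "finite T"
    using S T by (auto intro: finite_subset)
  obtain f where f: "bij_betw f S T"
    using finite_same_card_bij fin card by blast
  have "card ({..<n} - S) = card ({..<n} - T)"
    using S T fin card by (simp add: card_Diff_subset)
  then obtain g where g: "bij_betw g ({..<n} - S) ({..<n} - T)"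
    using finite_same_card_bij by (metis finite_Diff finite_lessThan)
  define \<pi> where "\<pi> x = (if x \<in> S then f x else g x)" for x
  have "bij_betw \<pi> (S \<union> ({..<n} - S)) (T \<union> ({..<n} - T))"
    unfolding \<pi>_def by (rule bij_betw_disjoint_Un[OF f g]) auto
  then have \<pi>: "bij_betw \<pi> {..<n} {..<n}"
    using S T by (simp add: Un_absorb1)
  have \<pi>S: "\<pi> ` S = T"
    using f by (auto simp: \<pi>_def bij_betw_def)
  have "inj_on ((`) ((`) \<pi>)) (Pow (Pow {..<n}))"
    using \<pi> by (intro inj_on_image_Pow) (auto simp: bij_betw_def)
  moreover have "{M \<in> perfect_matchings n. S \<in> saturated M} \<subseteq> Pow (Pow {..<n})"
    by (auto simp: perfect_matchings_def)
  ultimately have inj: "inj_on ((`) ((`) \<pi>)) {M \<in> perfect_matchings n. S \<in> saturated M}"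
    by (rule inj_on_subset)
  have "T \<in> saturated ((`) \<pi> ` M)" if M: "S \<in> saturated M" for M
  proof -
    obtain F where "F \<subseteq> M" "S = \<Union>F"
      using M by (auto simp: saturated_def)
    then have "T = \<Union>((`) \<pi> ` F)" "(`) \<pi> ` F \<subseteq> (`) \<pi> ` M"
      using \<pi>S by auto
    then show ?thesis
      unfolding saturated_def by blast
  qed
  then show ?thesis
    using image_perfect_matching[OF _ \<pi>] finite_perfect_matchings
    by (intro card_inj_on_le[OF inj]) auto
qed

text \<open>The left side is the middle term of Vandermonde's sum for the right side.\<close>

lemma binomial_square_le: "(m choose s)\<^sup>2 \<le> (2 * m) choose (2 * s)"
proof -
  have "(m choose s) * (m choose (2 * s - s)) \<le> (\<Sum>k\<le>2 * s. (m choose k) * (m choose (2 * s - k)))"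
    by (rule member_le_sum) auto
  also have "\<dots> = (2 * m) choose (2 * s)"
    by (subst vandermonde) (simp add: mult_2)
  finally show ?thesis
    by (simp add: power2_eq_square)
qed

text \<open>By symmetry each set of size \<open>2 * s\<close> is saturated by equally many matchings, and a single
  matching saturates only \<open>m choose s\<close> of the \<open>2 * m choose (2 * s)\<close> sets of this size.\<close>

lemma card_saturating_le:
  assumes S: "S \<subseteq> {..<2 * m}" "card S = 2 * s"
  shows "(m choose s) * card {M \<in> perfect_matchings (2 * m). S \<in> saturated M}
    \<le> card (perfect_matchings (2 * m))"
proof -
  let ?PM = "perfect_matchings (2 * m)"
  define N where "N = card {M \<in> ?PM. S \<in> saturated M}"
  define X where "X = {T. T \<subseteq> {..<2 * m} \<and> card T = 2 * s}"
  have finX: "finite X"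
    by (simp add: X_def)
  have cardX: "card X = (2 * m) choose (2 * s)"
    unfolding X_def using n_subsets[of "{..<2 * m}" "2 * s"] by simp
  have "\<forall>T\<in>X. card {M \<in> ?PM. T \<in> saturated M} = N"
    using S unfolding X_def N_def by (auto intro!: antisym card_saturating_mono)
  \<comment> \<open>Double counting of the pairs of a set in \<open>X\<close> and a matching that
    saturates it.\<close>
  then have "N * card X = (\<Sum>M\<in>?PM. card {T \<in> X. T \<in> saturated M})"
    using sum_multicount[of ?PM X "\<lambda>M T. T \<in> saturated M" N] finX finite_perfect_matchings
    by simp
  also have "\<dots> \<le> (\<Sum>M\<in>?PM. m choose s)"
  proof (rule sum_mono)
    fix M assume M: "M \<in> ?PM"
    have "card {T \<in> X. T \<in> saturated M} \<le> card {T \<in> saturated M. card T = 2 * s}"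
      using finite_saturated[OF M] by (intro card_mono) (auto simp: X_def)
    also have "\<dots> \<le> m choose s"
      using M by (rule card_saturated_size_le)
    finally show "card {T \<in> X. T \<in> saturated M} \<le> m choose s" .
  qed
  finally have "N * (2 * m choose (2 * s)) \<le> card ?PM * (m choose s)"
    by (simp add: cardX)
  \<comment> \<open>This replaces the ratio of \<open>m choose s\<close> to
    \<open>2 * m choose (2 * s)\<close> by the simpler bound 1 /
    \<open>(m choose s)\<close>.\<close>
  moreover have "N * (m choose s)\<^sup>2 \<le> N * (2 * m choose (2 * s))"
    by (intro mult_left_mono binomial_square_le) simp
  ultimately have "N * (m choose s)\<^sup>2 \<le> card ?PM * (m choose s)"
    by (rule order_trans[rotated])
  then have "(m choose s) * ((m choose s) * N) \<le> (m choose s) * card ?PM"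
    by (simp only: power2_eq_square mult_ac)
  moreover have "b * x \<le> y" if "b * (b * x) \<le> b * y" for b x y :: nat
    using that by (cases "b = 0") simp_all
  ultimately show ?thesis
    unfolding N_def by blast
qed

text \<open>Give each difference set D the weight q^(d - |D|), which is at least 1 on the ball, and
  sum over all subsets of \<open>V\<close>. A large \<open>q\<close> keeps the base of the first
  factor near 1; the price q^d is bearable when \<open>d\<close> is a small fraction of |V|.\<close>

lemma card_hamming_ball_le:
  fixes q :: real
  assumes q: "q \<ge> 1" and V: "finite V" "A \<subseteq> V"
  shows "real (card {S. S \<subseteq> V \<and> card (sym_diff S A) \<le> d}) \<le> (1 + 1 / q) ^ card V * q ^ d"
proof -
  let ?D = "{D. D \<subseteq> V \<and> card D \<le> d}"
  have "inj_on (\<lambda>S. sym_diff S A) {S. S \<subseteq> V \<and> card (sym_diff S A) \<le> d}"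
    by (rule inj_onI) blast
  then have "card {S. S \<subseteq> V \<and> card (sym_diff S A) \<le> d} \<le> card ?D"
    using V by (intro card_inj_on_le) auto
  then have "real (card {S. S \<subseteq> V \<and> card (sym_diff S A) \<le> d}) \<le> (\<Sum>D\<in>?D. 1)"
    by simp
  also have "\<dots> \<le> (\<Sum>D\<in>?D. q ^ d * (1 / q) ^ card D)"
  proof (rule sum_mono)
    fix D assume "D \<in> ?D"
    then have "q ^ card D \<le> q ^ d"
      using q by (auto intro: power_increasing)
    then show "1 \<le> q ^ d * (1 / q) ^ card D"
      using q by (simp add: power_one_over field_simps)
  qed
  also have "\<dots> \<le> (\<Sum>D\<in>Pow V. q ^ d * (1 / q) ^ card D)"
    using V q by (intro sum_mono2) auto
  also have "\<dots> = q ^ d * (\<Sum>D\<in>Pow V. (\<Prod>x\<in>D. 1 / q) * (\<Prod>x\<in>V - D. 1))"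
    by (simp add: sum_distrib_left)
  also have "\<dots> = q ^ d * (1 / q + 1) ^ card V"
    by (subst prod_add[OF V(1), symmetric]) simp
  finally show ?thesis
    by (simp add: algebra_simps)
qed

text \<open>The size window puts half of \<open>card T\<close> between \<open>t\<close> and
  \<open>m - t\<close>, where by unimodality the binomial coefficient is at least
  \<open>m choose t\<close>.\<close>

definition near_saturating :: "nat \<Rightarrow> nat \<Rightarrow> nat \<Rightarrow> nat set \<Rightarrow> nat set set set" where
  "near_saturating m d t S = {M \<in> perfect_matchings (2 * m).
     \<exists>T\<in>saturated M. card (sym_diff T S) \<le> d \<and> 2 * t \<le> card T \<and> card T + 2 * t \<le> 2 * m}"

lemma binomial_le_middle:
  assumes "t \<le> s" "s + t \<le> m"
  shows "m choose t \<le> m choose s"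
proof (cases "2 * s \<le> m")
  case True
  then show ?thesis using assms by (intro binomial_mono) auto
next
  case False
  then have "m choose t \<le> m choose (m - s)"
    using assms by (intro binomial_mono) auto
  then show ?thesis
    using assms by (simp add: binomial_symmetric[of s])
qed

text \<open>Union bound over the sets T in the Hamming ball around \<open>S\<close>; each is
  saturated by at most a fraction 1 / \<open>(m choose t)\<close> of all matchings.\<close>

lemma card_near_saturating_le:
  fixes q :: real
  assumes S: "S \<subseteq> {..<2 * m}" and q: "q \<ge> 1"
  shows "real (m choose t) * real (card (near_saturating m d t S))
    \<le> (1 + 1 / q) ^ (2 * m) * q ^ d * real (card (perfect_matchings (2 * m)))"
proof -
  let ?PM = "perfect_matchings (2 * m)"
  let ?W = "\<lambda>T. {M \<in> ?PM. T \<in> saturated M}"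
  let ?B = "{T. T \<subseteq> {..<2 * m} \<and> card (sym_diff T S) \<le> d}"
  define X where "X = {T \<in> ?B. 2 * t \<le> card T \<and> card T + 2 * t \<le> 2 * m}"
  have finX: "finite X"
    unfolding X_def by simp
  have W: "(m choose t) * card (?W T) \<le> card ?PM" if "T \<in> X" for T
  proof (cases "even (card T)")
    case True
    then obtain s where s: "card T = 2 * s" by blast
    have "m choose t \<le> m choose s"
      using that s by (intro binomial_le_middle) (auto simp: X_def)
    then have "(m choose t) * card (?W T) \<le> (m choose s) * card (?W T)"
      by simp
    also have "\<dots> \<le> card ?PM"
      using that s by (intro card_saturating_le) (auto simp: X_def)
    finally show ?thesis .
  next
    case False
    then have "card (?W T) = 0"
      using even_card_saturated by (metis (no_types, lifting) card.empty empty_Collect_eq)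
    then show ?thesis
      by (simp only: mult_0_right le0)
  qed
  have "near_saturating m d t S \<subseteq> (\<Union>T\<in>X. ?W T)"
  proof
    fix M assume "M \<in> near_saturating m d t S"
    then obtain T where T: "M \<in> ?PM" "T \<in> saturated M" "card (sym_diff T S) \<le> d"
      "2 * t \<le> card T" "card T + 2 * t \<le> 2 * m"
      unfolding near_saturating_def by blast
    moreover from this have "T \<subseteq> {..<2 * m}"
      using saturated_subset[OF T(2)] by (simp add: Union_perfect_matching)
    ultimately show "M \<in> (\<Union>T\<in>X. ?W T)"
      unfolding X_def by blast
  qed
  then have "card (near_saturating m d t S) \<le> card (\<Union>T\<in>X. ?W T)"
    using finX finite_perfect_matchings by (intro card_mono) auto
  also have "\<dots> \<le> (\<Sum>T\<in>X. card (?W T))"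
    using finX by (rule card_UN_le)
  finally have "(m choose t) * card (near_saturating m d t S) \<le> (\<Sum>T\<in>X. (m choose t) * card (?W T))"
    by (simp add: sum_distrib_left[symmetric])
  also have "\<dots> \<le> card X * card ?PM"
    using W sum_bounded_above[of X] by (metis (no_types, lifting) of_nat_id)
  also have "\<dots> \<le> card ?B * card ?PM"
    unfolding X_def by (intro mult_right_mono card_mono) auto
  finally have "real (m choose t) * real (card (near_saturating m d t S))
      \<le> real (card ?B) * real (card ?PM)"
    by (simp flip: of_nat_mult)
  also have "\<dots> \<le> (1 + 1 / q) ^ card {..<2 * m} * q ^ d * real (card ?PM)"
    using card_hamming_ball_le[OF q _ S, of d] by (intro mult_right_mono) auto
  finally show ?thesis by simp
qed

section \<open>Counting bad triples of matchings\<close>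

definition bad_triples :: "nat \<Rightarrow> nat \<Rightarrow> nat \<Rightarrow> (nat set set \<times> nat set set \<times> nat set set) set" where
  "bad_triples m d t = (SIGMA M : perfect_matchings (2 * m).
     \<Union>S\<in>saturated M. near_saturating m d t S \<times> near_saturating m d t S)"

text \<open>The factor \<open>2 ^ m\<close> counts the saturated sets of the first matching. For a
  fixed such set the conditions on the other two matchings are separate, hence the square.\<close>

lemma card_bad_triples_le:
  fixes q :: real
  assumes q: "q \<ge> 1" and t: "t \<le> m"
  shows "real (card (bad_triples m d t))
    \<le> 2 ^ m * ((1 + 1 / q) ^ (2 * m) * q ^ d / real (m choose t))\<^sup>2 * real (card (perfect_matchings (2 * m))) ^ 3"
proof -
  let ?PM = "perfect_matchings (2 * m)"
  define L where "L = real (card ?PM)"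
  define x where "x = (1 + 1 / q) ^ (2 * m) * q ^ d / real (m choose t)"
  have x: "x \<ge> 0"
    using q by (simp add: x_def)
  have pos: "real (m choose t) > 0"
    using t by simp
  have near: "real (card (near_saturating m d t S \<times> near_saturating m d t S)) \<le> (x * L)\<^sup>2"
    if "M \<in> ?PM" "S \<in> saturated M" for M S
  proof -
    have "S \<subseteq> {..<2 * m}"
      using saturated_subset[OF that(2)] that(1) by (simp add: Union_perfect_matching)
    from card_near_saturating_le[OF this q, of t d]
    have "real (card (near_saturating m d t S)) \<le> x * L"
      using pos by (simp add: x_def L_def field_simps)
    then show ?thesis
      by (simp add: card_cartesian_product power2_eq_square mult_mono')
  qed
  have fin: "finite (near_saturating m d t S)" for S
    using finite_perfect_matchings by (simp add: near_saturating_def)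
  have fib: "real (card (\<Union>S\<in>saturated M. near_saturating m d t S \<times> near_saturating m d t S))
      \<le> 2 ^ m * (x * L)\<^sup>2" if M: "M \<in> ?PM" for M
  proof -
    have "real (card (\<Union>S\<in>saturated M. near_saturating m d t S \<times> near_saturating m d t S))
        \<le> real (\<Sum>S\<in>saturated M. card (near_saturating m d t S \<times> near_saturating m d t S))"
      using card_UN_le[OF finite_saturated[OF M]] of_nat_mono by blast
    also have "\<dots> \<le> (\<Sum>S\<in>saturated M. (x * L)\<^sup>2)"
      unfolding of_nat_sum using near[OF M] by (intro sum_mono)
    also have "\<dots> = real (card (saturated M)) * (x * L)\<^sup>2"
      by simp
    also have "\<dots> \<le> 2 ^ m * (x * L)\<^sup>2"
      using card_saturated_le[OF M] by (intro mult_right_mono) (simp_all flip: of_nat_power add: of_nat_le_iff)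
    finally show ?thesis .
  qed
  have "real (card (bad_triples m d t))
      = (\<Sum>M\<in>?PM. real (card (\<Union>S\<in>saturated M. near_saturating m d t S \<times> near_saturating m d t S)))"
    unfolding bad_triples_def
    by (subst card_SigmaI) (use finite_perfect_matchings finite_saturated fin in auto)
  also have "\<dots> \<le> (\<Sum>M\<in>?PM. 2 ^ m * (x * L)\<^sup>2)"
    using fib by (rule sum_mono)
  also have "\<dots> = 2 ^ m * x\<^sup>2 * L ^ 3"
    by (simp add: L_def power2_eq_square power3_eq_cube)
  finally show ?thesis
    unfolding x_def L_def .
qed

section \<open>From counting to probabilities and to entanglement\<close>

lemma three_random_matchings_eq:
  assumes "even n"
  shows "three_random_matchings n
    = pmf_of_set (perfect_matchings n \<times> perfect_matchings n \<times> perfect_matchings n)"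
proof (rule pmf_eqI)
  fix x :: "nat set set \<times> nat set set \<times> nat set set"
  have *: "perfect_matchings n \<noteq> {}" "finite (perfect_matchings n)"
    using assms perfect_matchings_nonempty finite_perfect_matchings by auto
  obtain a b c where "x = (a, b, c)" by (cases x)
  then show "pmf (three_random_matchings n) x
      = pmf (pmf_of_set (perfect_matchings n \<times> perfect_matchings n \<times> perfect_matchings n)) x"
    using * by (simp add: three_random_matchings_def random_matching_def pmf_pair indicator_def
        card_cartesian_product)
qed

lemma prob_bad_triples_le:
  fixes q :: real
  assumes q: "q \<ge> 1" and t: "t \<le> m"
  shows "measure_pmf.prob (three_random_matchings (2 * m)) (bad_triples m d t)
    \<le> 2 ^ m * ((1 + 1 / q) ^ (2 * m) * q ^ d / real (m choose t))\<^sup>2"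
proof -
  let ?PM = "perfect_matchings (2 * m)"
  have PM: "?PM \<noteq> {}" "finite ?PM"
    using perfect_matchings_nonempty finite_perfect_matchings by auto
  then have pos: "real (card ?PM) > 0"
    by (simp add: card_gt_0_iff)
  have "measure_pmf.prob (three_random_matchings (2 * m)) (bad_triples m d t)
      = real (card ((?PM \<times> ?PM \<times> ?PM) \<inter> bad_triples m d t)) / real (card ?PM) ^ 3"
    using PM by (simp add: three_random_matchings_eq measure_pmf_of_set card_cartesian_product
        power3_eq_cube)
  also have "(?PM \<times> ?PM \<times> ?PM) \<inter> bad_triples m d t = bad_triples m d t"
    by (auto simp: bad_triples_def near_saturating_def)
  finally show ?thesis
    using card_bad_triples_le[OF q t, of d] pos by (simp add: divide_le_eq)
qed

lemma set_pmf_three_random_matchings: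
  assumes "even n"
  shows "set_pmf (three_random_matchings n)
    = perfect_matchings n \<times> perfect_matchings n \<times> perfect_matchings n"
  using assms perfect_matchings_nonempty finite_perfect_matchings
  by (subst three_random_matchings_eq) (auto intro!: set_pmf_of_set)

text \<open>The deterministic half of the argument: too small an entanglement number yields a
  separator, and its larger side makes the triple bad. The bound \<open>2 * k + 2 \<le> m\<close>
  makes the separator small enough for \<open>balanced_separator\<close>.\<close>

lemma ent_gt_if_not_bad:
  assumes M: "M1 \<in> perfect_matchings (2 * m)" "M2 \<in> perfect_matchings (2 * m)"
      "M3 \<in> perfect_matchings (2 * m)"
    and good: "(M1, M2, M3) \<notin> bad_triples m (Suc k) t"
    and k: "6 * t + Suc k \<le> 2 * m" "2 * k + 2 \<le> m"
  shows "ent {..<2 * m} (M1 \<union> M2 \<union> M3) > k"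
proof (rule ccontr)
  let ?V = "{..<2 * m}" and ?E = "M1 \<union> M2 \<union> M3"
  define k' where "k' = ent ?V ?E"
  assume "\<not> ?thesis"
  then have k': "k' \<le> k"
    by (simp add: k'_def)
  have E: "\<Union>?E \<subseteq> ?V" "\<And>e. e \<in> ?E \<Longrightarrow> card e = 2"
    using M Union_perfect_matching card_edge_perfect_matching by fast+
  have "cops_win k' ?V ?E"
    unfolding k'_def using E(1) by (intro cops_win_ent) auto
  then have "\<exists>C\<subseteq>?V. card C \<le> Suc k' \<and> (\<forall>v. \<not> in_giant ?V ?E C v)"
    using not_cops_win_if_giant[OF finite_lessThan E(1), of k'] by blast
  then obtain C where C: "C \<subseteq> ?V" "card C \<le> Suc k'" "\<And>v. \<not> in_giant ?V ?E C v"
    by blast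
  have "4 * card C \<le> card ?V"
    using C(2) k k' by simp
  from balanced_separator[OF _ E C(1) this C(3)] obtain A where A: "A \<subseteq> ?V - C"
    "\<And>e. e \<in> ?E \<Longrightarrow> e \<inter> A \<noteq> {} \<Longrightarrow> e \<subseteq> A \<union> C"
    "card (?V - C) \<le> 3 * card A" "3 * card A \<le> 2 * card (?V - C)"
    by (metis finite_lessThan)
  have finC: "finite C"
    using C(1) by (rule finite_subset) simp
  have finA: "finite A"
    using A(1) by (rule finite_subset) simp
  have card_VC: "card (?V - C) = 2 * m - card C"
    using C(1) finC by (simp add: card_Diff_subset)
  have hull: "\<exists>S\<in>saturated M. A \<subseteq> S \<and> S \<subseteq> A \<union> C"
    if "M \<in> perfect_matchings (2 * m)" "M \<subseteq> ?E" for M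
    using that A(1,2) by (intro ex_saturated_hull) auto
  obtain S where S: "S \<in> saturated M1" "A \<subseteq> S" "S \<subseteq> A \<union> C"
    using hull[OF M(1)] by blast
  have near: "M \<in> near_saturating m (Suc k) t S"
    if M: "M \<in> perfect_matchings (2 * m)" "M \<subseteq> ?E" for M
  proof -
    obtain T where T: "T \<in> saturated M" "A \<subseteq> T" "T \<subseteq> A \<union> C"
      using hull[OF M] by blast
    have "card (sym_diff T S) \<le> card C"
      using S T finC by (intro card_mono) auto
    moreover have "card A \<le> card T"
      using T finA finC by (intro card_mono) (auto intro: finite_subset)
    moreover have "card T \<le> card A + card C"
      using card_mono[OF _ T(3)] finA finC card_Un_le[of A C] by simp
    \<comment> \<open>With n = 2 m, |T| lies between |A|, at least (n - |C|) / 3, and |A| + |C|, at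
      most (2 n + |C|) / 3. Both ends of the size window then follow from
      \<open>6 * t + Suc k \<le> 2 * m\<close>.\<close>
    ultimately have "card (sym_diff T S) \<le> Suc k" "2 * t \<le> card T" "card T + 2 * t \<le> 2 * m"
      using A(3,4) C(2) k k' card_VC by linarith+
    with M(1) T(1) show ?thesis
      unfolding near_saturating_def by blast
  qed
  have "(M1, M2, M3) \<in> bad_triples m (Suc k) t"
    unfolding bad_triples_def using M(1) S(1) near[OF M(2)] near[OF M(3)] by blast
  with good show False ..
qed

section \<open>The union bound\<close>

text \<open>\<rho> is the exponential rate of the union bound for q = 200, d about m / 2000 and t
  about 3 m / 10. Its factors stem from the saturated sets of the first matching, the two parts of
  the Hamming ball bound, and the binomial coefficient, the last three squared.\<close>

lemma growth_rate_less_one: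
  fixes \<rho> :: real
  assumes "\<rho> = 2 * (201 / 200) ^ 4 * 200 powr (1 / 1000) * (3 / 10) powr (3 / 5)"
  shows "0 < \<rho>" "\<rho> < 1"
proof -
  \<comment> \<open>Since 200 < 2^8, this gives 200 < (26/25)^200, a rational bound for the 200th
    root of 200.\<close>
  have "(2::real) \<le> (26 / 25) ^ 25"
    using Bernoulli_inequality[of "1 / 25 :: real" 25] by simp
  then have "(2::real) ^ 8 \<le> ((26 / 25) ^ 25) ^ 8"
    by (intro power_mono) auto
  then have "(200::real) \<le> (26 / 25) ^ 200"
    unfolding power_mult[symmetric] by simp
  then have "(200::real) \<le> (26 / 25) powr 200"
    by (subst powr_numeral) auto
  then have "(200::real) powr (1 / 200) \<le> ((26 / 25) powr 200) powr (1 / 200)"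
    by (intro powr_mono2) auto
  then have a: "(200::real) powr (1 / 200) \<le> 26 / 25"
    unfolding powr_powr by simp
  \<comment> \<open>The fifth power clears the exponent 3/5; what remains is about 0.993.\<close>
  have "(200 powr (1 / 1000)) ^ 5 = (200::real) powr (1 / 200)"
    by (simp add: powr_power)
  moreover have "((3 / 10) powr (3 / 5)) ^ 5 = (3 / 10 :: real) ^ 3"
    by (simp add: powr_power)
  ultimately have "\<rho> ^ 5 = 32 * (201 / 200) ^ 20 * 200 powr (1 / 200) * (3 / 10) ^ 3"
    unfolding assms power_mult_distrib by (simp flip: power_mult)
  also have "\<dots> \<le> 32 * (201 / 200) ^ 20 * (26 / 25) * (3 / 10) ^ 3"
    using a by (intro mult_right_mono mult_left_mono) auto
  also have "\<dots> < 1"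
    by (simp add: power_divide)
  finally have less: "\<rho> ^ 5 < 1" .
  show pos: "0 < \<rho>"
    by (simp add: assms)
  show "\<rho> < 1"
    using less pos power_less_one_iff[of \<rho> 5] by simp
qed

lemma bad_triples_bound_tendsto:
  "(\<lambda>m. 2 ^ m * ((1 + 1 / 200) ^ (2 * m) * 200 ^ Suc (m div 2000) / real (m choose (3 * m div 10)))\<^sup>2)
    \<longlonglongrightarrow> (0::real)" (is "?b \<longlonglongrightarrow> 0")
proof -
  define \<rho> :: real where
    "\<rho> = 2 * (201 / 200) ^ 4 * 200 powr (1 / 1000) * (3 / 10) powr (3 / 5)"
  note \<rho> = growth_rate_less_one[OF \<rho>_def]
  \<comment> \<open>\<open>K\<close> pays for rounding: \<open>t\<close> may fall short of 3 m / 10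
    by less than 1, and \<open>Suc d\<close> exceeds m / 2000 by at most 1, both squared.\<close>
  define K :: real where "K = 200\<^sup>2 * (10 / 3)\<^sup>2"
  have bound: "?b m \<le> K * \<rho> ^ m" for m
  proof -
    define t where "t = 3 * m div 10"
    define d where "d = m div 2000"
    have "10 * t \<le> 3 * m" "3 * m < 10 * t + 10" "2000 * d \<le> m"
      unfolding t_def d_def using dividend_less_times_div[of 10 "3 * m"] by simp_all
    then have "real (10 * t) \<le> real (3 * m)" "real (3 * m) \<le> real (10 * t + 10)"
        "real (2000 * d) \<le> real m"
      unfolding of_nat_le_iff by simp_all
    then have t: "10 * real t \<le> 3 * real m" "3 / 5 * real m - 2 \<le> real (2 * t)"
      and d: "real (2 * Suc d) \<le> 2 + real m / 1000"
      by simp_all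
    have "(10 / 3) ^ t \<le> (real m / real t) ^ t"
    proof (cases "t = 0")
      case False
      then have "10 / 3 \<le> real m / real t"
        using t by (simp add: field_simps)
      then show ?thesis
        by (intro power_mono) auto
    qed simp
    also have "\<dots> \<le> real (m choose t)"
      using t by (intro binomial_ge_n_over_k_pow_k) simp
    finally have "1 / real (m choose t) \<le> 1 / (10 / 3) ^ t"
      by (intro frac_le) auto
    then have "(1 / real (m choose t))\<^sup>2 \<le> (1 / (10 / 3) ^ t)\<^sup>2"
      by (intro power_mono) auto
    also have "\<dots> = (3 / 10) ^ (2 * t)"
      by (simp add: mult.commute flip: power_one_over power_mult)
    also have "\<dots> = (3 / 10) powr real (2 * t)"
      by (rule powr_realpow [symmetric]) simp
    also have "\<dots> \<le> (3 / 10) powr (3 / 5 * real m - 2)"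
      using t by (intro powr_mono') auto
    also have "\<dots> = (10 / 3)\<^sup>2 * ((3 / 10) powr (3 / 5)) ^ m"
      by (simp add: powr_diff powr_power power2_eq_square mult.commute)
    finally have b: "(1 / real (m choose t))\<^sup>2 \<le> (10 / 3)\<^sup>2 * ((3 / 10) powr (3 / 5)) ^ m" .
    have "(200 ^ Suc d)\<^sup>2 = (200::real) ^ (2 * Suc d)"
      by (simp only: power_mult [symmetric] mult.commute)
    also have "\<dots> = 200 powr real (2 * Suc d)"
      by (rule powr_realpow [symmetric]) simp
    also have "\<dots> \<le> 200 powr (2 + real m / 1000)"
      using d by (intro powr_mono) auto
    also have "\<dots> = 200\<^sup>2 * (200 powr (1 / 1000)) ^ m"
      by (simp add: powr_add powr_power)
    finally have c: "(200 ^ Suc d)\<^sup>2 \<le> (200::real)\<^sup>2 * (200 powr (1 / 1000)) ^ m" .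
    have sq: "(y * z / c)\<^sup>2 = y\<^sup>2 * (z\<^sup>2 * (1 / c)\<^sup>2)" for y z c :: real
      by (simp add: power_mult_distrib power_divide)
    have quart: "(x ^ (2 * m))\<^sup>2 = (x ^ 4) ^ m" for x :: real
      by (simp flip: power_mult)
    have base: "1 + 1 / 200 = (201 / 200 :: real)"
      by simp
    have "?b m = 2 ^ m * ((201 / 200) ^ 4) ^ m * ((200 ^ Suc d)\<^sup>2 * (1 / real (m choose t))\<^sup>2)"
      unfolding t_def[symmetric] d_def[symmetric] sq quart base by (rule mult.assoc [symmetric])
    also have "\<dots> \<le> 2 ^ m * ((201 / 200) ^ 4) ^ m *
        (200\<^sup>2 * (200 powr (1 / 1000)) ^ m * ((10 / 3)\<^sup>2 * ((3 / 10) powr (3 / 5)) ^ m))"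
      using b c by (intro mult_left_mono mult_mono) auto
    also have "\<dots> = K * \<rho> ^ m"
      unfolding K_def \<rho>_def power_mult_distrib by (simp only: mult_ac)
    finally show ?thesis .
  qed
  show ?thesis
  proof (rule tendsto_sandwich[of "\<lambda>_. 0"])
    show "(\<lambda>m. K * \<rho> ^ m) \<longlonglongrightarrow> 0"
      using \<rho> by (intro tendsto_mult_right_zero LIMSEQ_realpow_zero) auto
  qed (use bound in \<open>auto intro!: always_eventually\<close>)
qed

theorem theorem2:
  "\<exists>\<alpha>::real. \<alpha> > 0 \<and>
     (\<lambda>m. measure_pmf.prob (three_random_matchings (2 * m))
        {(M1, M2, M3). real (ent {..<2 * m} (M1 \<union> M2 \<union> M3)) > \<alpha> * real (2 * m)})
     \<longlonglongrightarrow> 1"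
proof (intro exI conjI)
  \<comment> \<open>The constant 1/4000 matches \<open>m div 2000\<close> cops on
    \<open>2 * m\<close> vertices.\<close>
  let ?G = "\<lambda>m. {(M1, M2, M3). real (ent {..<2 * m} (M1 \<union> M2 \<union> M3)) > 1 / 4000 * real (2 * m)}"
  let ?p = "\<lambda>m. measure_pmf.prob (three_random_matchings (2 * m))"
  let ?B = "\<lambda>m. bad_triples m (Suc (m div 2000)) (3 * m div 10)"
  define b :: "nat \<Rightarrow> real" where
    "b m = 2 ^ m * ((1 + 1 / 200) ^ (2 * m) * 200 ^ Suc (m div 2000)
      / real (m choose (3 * m div 10)))\<^sup>2" for m
  \<comment> \<open>Since 6 t can reach 9 m / 5, the remaining m / 5 must cover
    \<open>Suc d\<close>; \<open>m \<ge> 10\<close> is ample.\<close>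
  have "1 - b m \<le> ?p m (?G m)" if m: "m \<ge> 10" for m
  proof -
    have "?p m (- ?B m) \<le> ?p m (?G m)"
    proof (rule measure_pmf.finite_measure_mono_AE)
      show "AE x in three_random_matchings (2 * m). x \<in> - ?B m \<longrightarrow> x \<in> ?G m"
        unfolding AE_measure_pmf_iff
      proof (intro ballI impI)
        fix x assume x: "x \<in> set_pmf (three_random_matchings (2 * m))" "x \<in> - ?B m"
        obtain M1 M2 M3 where x_eq: "x = (M1, M2, M3)" by (cases x)
        have k: "2 * d + 2 \<le> m" "6 * t + Suc d \<le> 2 * m"
          if "2000 * d \<le> m" "10 * t \<le> 3 * m" for t d
          using m that by linarith+
        have "m div 2000 < ent {..<2 * m} (M1 \<union> M2 \<union> M3)"
        proof (rule ent_gt_if_not_bad)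
          show "M1 \<in> perfect_matchings (2 * m)" "M2 \<in> perfect_matchings (2 * m)"
              "M3 \<in> perfect_matchings (2 * m)"
            using x(1) by (simp_all add: x_eq set_pmf_three_random_matchings)
          show "(M1, M2, M3) \<notin> bad_triples m (Suc (m div 2000)) (3 * m div 10)"
            using x(2) by (simp only: x_eq Compl_iff not_False_eq_True)
          show "6 * (3 * m div 10) + Suc (m div 2000) \<le> 2 * m"
            by (rule k(2)) simp_all
          show "2 * (m div 2000) + 2 \<le> m"
            by (rule k(1)[of _ 0]) simp_all
        qed
        \<comment> \<open>Rounding costs nothing here: an integer above \<open>m div 2000\<close>
          also exceeds m / 2000.\<close>
        moreover have "1 / 4000 * real (2 * m) < real e" if e: "m div 2000 < e" for e
        proof -
          have "m < e * 2000"
            using e by (simp add: div_less_iff_less_mult)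
          then have "real m < real (e * 2000)"
            by (simp only: of_nat_less_iff)
          then show ?thesis by simp
        qed
        ultimately show "x \<in> ?G m"
          unfolding x_eq mem_Collect_eq prod.case by blast
      qed
    qed simp
    moreover have "?p m (- ?B m) = 1 - ?p m (?B m)"
      using measure_pmf.prob_compl[of "?B m"] by (simp add: Compl_eq_Diff_UNIV)
    moreover have "?p m (?B m) \<le> b m"
      unfolding b_def by (rule prob_bad_triples_le) auto
    ultimately show ?thesis by linarith
  qed
  then have lower: "\<forall>\<^sub>F m in sequentially. 1 - b m \<le> ?p m (?G m)"
    by (rule eventually_sequentiallyI)
  have upper: "\<forall>\<^sub>F m in sequentially. ?p m (?G m) \<le> 1"
    by simp
  have lim: "(\<lambda>m. 1 - b m) \<longlonglongrightarrow> 1 - 0"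
    unfolding b_def by (intro tendsto_diff tendsto_const bad_triples_bound_tendsto)
  show "(\<lambda>m. ?p m (?G m)) \<longlonglongrightarrow> 1"
    using lower upper lim[unfolded diff_zero] tendsto_const by (rule tendsto_sandwich)
qed simp

end
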